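(* Boolean formulas (modelled by Boolean circuits with bounded fan-in) reduce to poset games via the construction given in the context: the result for a Boolean formula is a single poset game, which is a first-player win if and only if the formula evaluates to true. If the Boolean formula is one that can be evaluated by log-depth circuits, the poset game it is reduced to has polynomial size. Hence finding the winning player of a (finite) poset game is an $NC^1$-hard problem.
   Context: A poset game is played on a finite partially ordered set. Two players alternate moves; a move consists of choosing a remaining element $v$ and removing all remaining elements $w$ with $w\ge v$. A player who cannot move because no elements remain loses. A game is a first-player win if the player who moves first has a winning strategy. Adding a bottom vertex to a game means adjoining one new element less than all elements present at that time. An $x$-tower is a chain of $x$ elements. Putting games next to each other means taking the disjoint union of the posets, with elements of different components incomparable (separate copies are used when a game occurs more than once). The reduction replaces the formula's variables (with their given truth values) and gates as follows. A true variable is represented by the poset game with a single element (a first-player win); a false variable by the poset game with two incomparable elements (a first-player loss). Gates are then applied one after another: NOT: for a poset game $G$ with $g$ elements, $\neg G$ is produced as follows. (1) Set $i=0$. (2) While $2^i\le g$, add $2^i$ bottom vertices (in sequence) to the current game (initially $G$), then put it next to a $2^i$-tower, then increment $i$ by $1$. (3) Let the resulting game be $G'$. (4) To a copy of $G'$ add $2^i$ bottom vertices and put it next to a $2^i$-tower to get $G''$; increment $i$ by $1$. (5) Put $G'$ next to $G''$ and a $2^i$-tower to get $\neg G$. The size of $\neg G$ is linear in $g$, and the relation between any two of its vertices can be computed in polylogarithmic time given the relations of $G$. OR: $A\cup B$ is the poset whose elements are those of $A$ together with those of $B$, with the relations of $A$ and of $B$ and in addition $b\ge a$ for all $a\in A$,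 $b\in B$. AND: $A\cap B=\neg(\neg A\cup\neg B)$. For a formula that can be evaluated by log-depth circuits, the game is the one obtained by applying these gate constructions to a log-depth, bounded fan-in circuit evaluating it, with fresh copies of subgames where a gate's output is reused; polynomial size means polynomial in the size of the input. $NC^1$ is the class of problems solvable by logarithmic-depth, polynomial-size Boolean circuits with bounded fan-in; a problem is $NC^1$-hard if every problem in $NC^1$ reduces to it efficiently. *)

theory Defs
  imports "HOL-Library.Landau_Symbols" "HOL-Library.While_Combinator"
begin

section \<open>Poset games\<close>

text \<open>
  A poset is given by its reflexive order relation \<open>r\<close>: its set of elements is \<^term>\<open>Field r\<close>, and
  \<open>(v, w) \<in> r\<close> means \<open>v \<le> w\<close>. A position of the game is the set of remaining elements.
\<close>

definition finite_poset :: "'a rel \<Rightarrow> bool" where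
  "finite_poset r \<longleftrightarrow> finite (Field r) \<and> Partial_order r"

definition move :: "'a rel \<Rightarrow> 'a set \<Rightarrow> 'a \<Rightarrow> 'a set" where
  "move r S v = S - {w. (v, w) \<in> r}"

text \<open>
  A strategy chooses an element in each position. \<open>first_turns r \<sigma>\<close> is the set of positions that can
  arise when the first player is to move, if he has always played a legal move prescribed by \<open>\<sigma>\<close>
  while the second player has moved arbitrarily. Since every play on a finite poset ends, and
  the player who cannot move loses, \<open>\<sigma>\<close> is winning iff it never leaves the first player without
  a move.
\<close>

inductive_set first_turns :: "'a rel \<Rightarrow> ('a set \<Rightarrow> 'a) \<Rightarrow> 'a set set"
  for r :: "'a rel" and \<sigma> :: "'a set \<Rightarrow> 'a" where
  start: "Field r \<in> first_turns r \<sigma>"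
| round: "\<lbrakk>S \<in> first_turns r \<sigma>; \<sigma> S \<in> S; w \<in> move r S (\<sigma> S)\<rbrakk>
    \<Longrightarrow> move r (move r S (\<sigma> S)) w \<in> first_turns r \<sigma>"

definition first_player_win :: "'a rel \<Rightarrow> bool" where
  "first_player_win r \<longleftrightarrow> (\<exists>\<sigma>. \<forall>S \<in> first_turns r \<sigma>. \<sigma> S \<in> S)"


section \<open>Gate constructions\<close>

text \<open>
  All constructed games live on natural numbers. The copies of \<open>r\<close> and \<open>s\<close> on the even and the odd
  numbers are disjoint, so a game may be used several times.
\<close>

definition beside :: "nat rel \<Rightarrow> nat rel \<Rightarrow> nat rel" where
  "beside r s = {(2 * a, 2 * b) | a b. (a, b) \<in> r} \<union> {(2 * a + 1, 2 * b + 1) | a b. (a, b) \<in> s}"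

definition add_bottom :: "nat rel \<Rightarrow> nat rel" where
  "add_bottom r = {(0, 0)} \<union> {(0, Suc a) | a. a \<in> Field r} \<union> {(Suc a, Suc b) | a b. (a, b) \<in> r}"

definition tower :: "nat \<Rightarrow> nat rel" where
  "tower x = {(i, j). i \<le> j \<and> j < x}"

definition var_game :: "bool \<Rightarrow> nat rel" where
  "var_game b = (if b then {(0, 0)} else {(0, 0), (1, 1)})"

definition bottoms_and_tower :: "nat \<Rightarrow> nat rel \<Rightarrow> nat rel" where
  "bottoms_and_tower i G = beside ((add_bottom ^^ (2 ^ i)) G) (tower (2 ^ i))"

definition not_game :: "nat rel \<Rightarrow> nat rel" where
  "not_game G =
    (let g = card (Field G);
         (i, G') = while (\<lambda>(i, H). 2 ^ i \<le> g) (\<lambda>(i, H). (i + 1, bottoms_and_tower i H)) (0, G);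
         G'' = bottoms_and_tower i G'
     in beside (beside G' G'') (tower (2 ^ (i + 1))))"

definition or_game :: "nat rel \<Rightarrow> nat rel \<Rightarrow> nat rel" where
  "or_game A B = beside A B \<union> {(2 * a, 2 * b + 1) | a b. a \<in> Field A \<and> b \<in> Field B}"

definition and_game :: "nat rel \<Rightarrow> nat rel \<Rightarrow> nat rel" where
  "and_game A B = not_game (or_game (not_game A) (not_game B))"


section \<open>Boolean circuits of bounded fan-in\<close>

text \<open>
  A circuit is a list of gates in topological order; gates refer to their inputs by list position,
  and the last gate is the output. A gate output may be used several times.
\<close>

datatype gate = InputG nat | ConstG bool | NotG nat | AndG nat nat | OrG nat nat

fun gate_args :: "gate \<Rightarrow> nat list" where
  "gate_args (InputG k) = []"
| "gate_args (ConstG b) = []"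
| "gate_args (NotG i) = [i]"
| "gate_args (AndG i j) = [i, j]"
| "gate_args (OrG i j) = [i, j]"

definition circuit :: "nat \<Rightarrow> gate list \<Rightarrow> bool" where
  "circuit n C \<longleftrightarrow> C \<noteq> [] \<and> (\<forall>k. InputG k \<in> set C \<longrightarrow> k < n) \<and>
    (\<forall>i < length C. \<forall>j \<in> set (gate_args (C ! i)). j < i)"

text \<open>The value at the output, where \<open>f vs g\<close> is the value at gate \<open>g\<close> given the values \<open>vs\<close> at all
  preceding gates.\<close>

definition out_val :: "('v list \<Rightarrow> 'g \<Rightarrow> 'v) \<Rightarrow> 'g list \<Rightarrow> 'v" where
  "out_val f C = last (foldl (\<lambda>vs g. vs @ [f vs g]) [] C)"

fun gate_eval :: "bool list \<Rightarrow> bool list \<Rightarrow> gate \<Rightarrow> bool" where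
  "gate_eval x vs (InputG k) = x ! k"
| "gate_eval x vs (ConstG b) = b"
| "gate_eval x vs (NotG i) = (\<not> vs ! i)"
| "gate_eval x vs (AndG i j) = (vs ! i \<and> vs ! j)"
| "gate_eval x vs (OrG i j) = (vs ! i \<or> vs ! j)"

fun gate_depth :: "nat list \<Rightarrow> gate \<Rightarrow> nat" where
  "gate_depth vs (InputG k) = 0"
| "gate_depth vs (ConstG b) = 0"
| "gate_depth vs (NotG i) = Suc (vs ! i)"
| "gate_depth vs (AndG i j) = Suc (max (vs ! i) (vs ! j))"
| "gate_depth vs (OrG i j) = Suc (max (vs ! i) (vs ! j))"

fun gate_game :: "bool list \<Rightarrow> nat rel list \<Rightarrow> gate \<Rightarrow> nat rel" where
  "gate_game x vs (InputG k) = var_game (x ! k)"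
| "gate_game x vs (ConstG b) = var_game b"
| "gate_game x vs (NotG i) = not_game (vs ! i)"
| "gate_game x vs (AndG i j) = and_game (vs ! i) (vs ! j)"
| "gate_game x vs (OrG i j) = or_game (vs ! i) (vs ! j)"

definition circuit_eval :: "gate list \<Rightarrow> bool list \<Rightarrow> bool" where
  "circuit_eval C x = out_val (gate_eval x) C"

definition circuit_depth :: "gate list \<Rightarrow> nat" where
  "circuit_depth C = out_val gate_depth C"

definition circuit_game :: "gate list \<Rightarrow> bool list \<Rightarrow> nat rel" where
  "circuit_game C x = out_val (gate_game x) C"


section \<open>Complexity\<close>

definition polynomially_bounded :: "(nat \<Rightarrow> nat) \<Rightarrow> bool" where
  "polynomially_bounded p \<longleftrightarrow> (\<exists>k. (\<lambda>n. real (p n)) \<in> O(\<lambda>n. real n ^ k))"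

definition NC1 :: "bool list set set" where
  "NC1 = {L. \<exists>C. (\<forall>n. circuit n (C n)) \<and>
    polynomially_bounded (\<lambda>n. length (C n)) \<and>
    (\<lambda>n. real (circuit_depth (C n))) \<in> O(\<lambda>n. ln (real n)) \<and>
    (\<forall>x. x \<in> L \<longleftrightarrow> circuit_eval (C (length x)) x)}"

text \<open>
  Efficient reductions are many-one reductions computable by circuits of constant depth, polynomial
  size and unbounded fan-in. Like the circuits defining \<^const>\<open>NC1\<close>, these are
  not required to be uniform. (Polynomial-time, or even \<^const>\<open>NC1\<close>, reductions would make
  \<^const>\<open>NC1\<close>-hardness trivial.)
\<close>

datatype ac_gate = InputU nat | NotU nat | AndU "nat list" | OrU "nat list"

fun ac_args :: "ac_gate \<Rightarrow> nat list" where
  "ac_args (InputU k) = []"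
| "ac_args (NotU i) = [i]"
| "ac_args (AndU is) = is"
| "ac_args (OrU is) = is"

definition ac_circuit :: "nat \<Rightarrow> ac_gate list \<Rightarrow> bool" where
  "ac_circuit n C \<longleftrightarrow> C \<noteq> [] \<and> (\<forall>k. InputU k \<in> set C \<longrightarrow> k < n) \<and>
    (\<forall>i < length C. \<forall>j \<in> set (ac_args (C ! i)). j < i)"

fun ac_gate_eval :: "bool list \<Rightarrow> bool list \<Rightarrow> ac_gate \<Rightarrow> bool" where
  "ac_gate_eval x vs (InputU k) = x ! k"
| "ac_gate_eval x vs (NotU i) = (\<not> vs ! i)"
| "ac_gate_eval x vs (AndU is) = (\<forall>i \<in> set is. vs ! i)"
| "ac_gate_eval x vs (OrU is) = (\<exists>i \<in> set is. vs ! i)"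

fun ac_gate_depth :: "nat list \<Rightarrow> ac_gate \<Rightarrow> nat" where
  "ac_gate_depth vs (InputU k) = 0"
| "ac_gate_depth vs (NotU i) = Suc (vs ! i)"
| "ac_gate_depth vs (AndU is) = Suc (Max (insert 0 ((!) vs ` set is)))"
| "ac_gate_depth vs (OrU is) = Suc (Max (insert 0 ((!) vs ` set is)))"

text \<open>\<open>D n i\<close> computes the \<open>i\<close>-th output bit on inputs of length \<open>n\<close>.\<close>

definition reduces_efficiently :: "bool list set \<Rightarrow> bool list set \<Rightarrow> bool" where
  "reduces_efficiently A B \<longleftrightarrow> (\<exists>l D s d. polynomially_bounded l \<and> polynomially_bounded s \<and>
    (\<forall>n. \<forall>i < l n. ac_circuit n (D n i) \<and> length (D n i) \<le> s n \<and>
      out_val ac_gate_depth (D n i) \<le> d) \<and>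
    (\<forall>x. x \<in> A \<longleftrightarrow>
      map (\<lambda>i. out_val (ac_gate_eval x) (D (length x) i)) [0..<l (length x)] \<in> B))"

definition NC1_hard :: "bool list set \<Rightarrow> bool" where
  "NC1_hard B \<longleftrightarrow> (\<forall>A \<in> NC1. reduces_efficiently A B)"

text \<open>A poset on \<open>{0..<m}\<close> is encoded by the matrix of its order relation, row by row.\<close>

definition encode_poset :: "nat \<Rightarrow> nat rel \<Rightarrow> bool list" where
  "encode_poset m r = concat (map (\<lambda>i. map (\<lambda>j. (i, j) \<in> r) [0..<m]) [0..<m])"

definition poset_game_problem :: "bool list set" where
  "poset_game_problem =
    {encode_poset m r | m r. Field r = {..<m} \<and> finite_poset r \<and> first_player_win r}"

end

theory Submission
  imports Defs
begin

text \<open>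
  On Grundy values, putting games side by side is \<open>xor\<close>, a bottom vertex adds one, and an \<open>x\<close>-tower
  has value \<open>x\<close>. Adding \<open>2^i\<close> bottom vertices and a \<open>2^i\<close>-tower therefore maps \<open>v\<close> to
  \<open>xor (v + 2^i) (2^i)\<close>, which is \<open>v\<close> if bit \<open>i\<close> of \<open>v\<close> is \<open>0\<close> and \<open>v + 2^(i+1)\<close> otherwise. Starting from
  \<open>n\<close>, this carries a nonzero \<open>n < 2^i\<close> to a number in \<open>{2^i..<2^(i+1)}\<close> after \<open>i\<close> steps and leaves \<open>0\<close>
  fixed; the last step of the negation then separates the two cases. Every gate multiplies the size
  by a constant, so the size is exponential in the depth.

  For hardness, a variable is represented by a 2-tower or a 2-antichain instead. The set of elements
  then no longer depends on the input, and neither does any relation between two elements,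
  except that inside a leaf it is an input bit. Hence every bit of the encoded poset is a
  constant or an input bit.
\<close>

section \<open>Basic facts on finite posets\<close>

lemma finite_posetD:
  assumes "finite_poset r"
  shows finite_poset_finite: "finite r" and finite_poset_Field: "Field r = {v. (v, v) \<in> r}"
    and finite_poset_trans: "trans r" and finite_poset_antisym: "antisym r"
proof -
  have *: "finite (Field r)" "Partial_order r"
    using assms by (auto simp: finite_poset_def)
  show "finite r"
    using * by (meson finite_SigmaI finite_subset subsetI FieldI1 FieldI2 mem_Sigma_iff subrelI)
  show "trans r" "antisym r"
    using * by (auto simp: partial_order_on_def preorder_on_def)
  show "Field r = {v. (v, v) \<in> r}"
    using * by (auto simp: partial_order_on_def preorder_on_def refl_on_def intro: FieldI1)
qed

lemma finite_posetI:
  assumes "finite r" "\<And>a b. (a, b) \<in> r \<Longrightarrow> (a, a) \<in> r \<and> (b, b) \<in> r" "trans r" "antisym r"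
  shows "finite_poset r"
  using assms unfolding finite_poset_def partial_order_on_def preorder_on_def refl_on_def
  by (auto simp: Field_def finite_Domain finite_Range)

section \<open>Grundy values\<close>

text \<open>A move turned into an operation on posets, so that the Grundy recursion can range over
  relations instead of positions inside a fixed one.\<close>

definition remove :: "'a rel \<Rightarrow> 'a \<Rightarrow> 'a rel" where
  "remove r v = {(a, b) \<in> r. (v, a) \<notin> r \<and> (v, b) \<notin> r}"

lemma remove_iff: "(a, b) \<in> remove r v \<longleftrightarrow> (a, b) \<in> r \<and> (v, a) \<notin> r \<and> (v, b) \<notin> r"
  by (simp add: remove_def)

text \<open>The least value not attained by an option. The guards inside the set serve termination
  for arbitrary relations: \<open>(v, v) \<in> r\<close> makes \<open>remove r v\<close> a proper
  subset and finiteness makes its cardinality drop.\<close>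

function grundy :: "'a rel \<Rightarrow> nat" where
  "grundy r = (LEAST n. n \<notin> (\<lambda>v. grundy (remove r v)) ` {v. finite r \<and> (v, v) \<in> r})"
  by auto
termination
proof (relation "measure card")
  fix r :: "'a rel" and v
  assume "v \<in> {v. finite r \<and> (v, v) \<in> r}"
  then have "finite r" "remove r v \<subset> r"
    by (auto simp: remove_def)
  then show "(remove r v, r) \<in> measure card"
    by (simp add: psubset_card_mono)
qed simp

declare grundy.simps [simp del]

lemma finite_poset_remove:
  assumes "finite_poset r"
  shows "finite_poset (remove r v)"
proof (rule finite_posetI)
  show "finite (remove r v)"
    by (rule finite_subset[OF _ finite_poset_finite[OF assms]]) (auto simp: remove_def)
  show "trans (remove r v)"
    using finite_poset_trans[OF assms] unfolding trans_def remove_def by blast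
  show "antisym (remove r v)"
    using finite_poset_antisym[OF assms] unfolding antisym_def remove_def by blast
  fix a b
  assume "(a, b) \<in> remove r v"
  then show "(a, a) \<in> remove r v \<and> (b, b) \<in> remove r v"
    using finite_poset_Field[OF assms] by (auto simp: remove_def dest: FieldI1 FieldI2)
qed

lemma Field_remove:
  assumes "finite_poset r"
  shows "Field (remove r v) = Field r - {w. (v, w) \<in> r}"
  using finite_poset_Field[OF assms] finite_poset_Field[OF finite_poset_remove[OF assms, of v]]
  by (auto simp: remove_def)

text \<open>Induction on the number of elements: by reflexivity the chosen element disappears
  itself.\<close>

lemma finite_poset_induct [consumes 1, case_names remove]:
  assumes "finite_poset r"
    and step: "\<And>r. finite_poset r \<Longrightarrow> (\<And>v. v \<in> Field r \<Longrightarrow> P (remove r v)) \<Longrightarrow> P r"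
  shows "P r"
  using assms(1)
proof (induction "card (Field r)" arbitrary: r rule: less_induct)
  case less
  show ?case
  proof (rule step[OF less.prems])
    fix v
    assume "v \<in> Field r"
    then have "Field (remove r v) \<subset> Field r"
      using Field_remove[OF less.prems, of v] finite_poset_Field[OF less.prems] by auto
    then have "card (Field (remove r v)) < card (Field r)"
      using less.prems by (simp add: finite_poset_def psubset_card_mono)
    then show "P (remove r v)"
      by (intro less.hyps finite_poset_remove less.prems)
  qed
qed

lemma grundy_eq:
  assumes "finite_poset r"
  shows "grundy r = (LEAST n. n \<notin> (\<lambda>v. grundy (remove r v)) ` Field r)"
  using finite_poset_finite[OF assms] by (subst grundy.simps) (simp add: finite_poset_Field[OF assms])

lemma grundy_eqI:
  assumes "finite_poset r" "\<And>v. v \<in> Field r \<Longrightarrow> grundy (remove r v) \<noteq> n"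
    and "\<And>k. k < n \<Longrightarrow> \<exists>v \<in> Field r. grundy (remove r v) = k"
  shows "grundy r = n"
  unfolding grundy_eq[OF assms(1)]
proof (rule Least_equality)
  show "n \<notin> (\<lambda>v. grundy (remove r v)) ` Field r"
    using assms(2) by auto
  show "n \<le> k" if "k \<notin> (\<lambda>v. grundy (remove r v)) ` Field r" for k
    using assms(3)[of k] that by (force simp: not_le[symmetric])
qed

text \<open>Finiteness is the point: the option values miss some number, so \<open>LEAST\<close> is
  attained outside them.\<close>

lemma grundy_remove_neq:
  assumes "finite_poset r" "v \<in> Field r"
  shows "grundy (remove r v) \<noteq> grundy r"
proof -
  let ?A = "(\<lambda>v. grundy (remove r v)) ` Field r"
  have "finite ?A"
    using assms by (simp add: finite_poset_def)
  then have "\<exists>n. n \<notin> ?A"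
    using ex_new_if_finite infinite_UNIV_nat by blast
  then have "grundy r \<notin> ?A"
    unfolding grundy_eq[OF assms(1)] by (rule LeastI_ex)
  then show ?thesis
    using assms(2) by (metis imageI)
qed

lemma less_grundyE:
  assumes "finite_poset r" "k < grundy r"
  obtains v where "v \<in> Field r" "grundy (remove r v) = k"
  using not_less_Least[OF assms(2)[unfolded grundy_eq[OF assms(1)]]] by auto

lemma grundy_eq_0_iff:
  assumes "finite_poset r"
  shows "grundy r = 0 \<longleftrightarrow> (\<forall>v \<in> Field r. grundy (remove r v) \<noteq> 0)"
  using grundy_remove_neq[OF assms] less_grundyE[OF assms, of 0] by (metis gr0I)

text \<open>Value \<open>Suc n\<close> requires an option of value \<open>n\<close>, which has fewer
  elements. This bound later ensures that the NOT loop runs long enough.\<close>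

lemma grundy_le_card:
  assumes "finite_poset r"
  shows "grundy r \<le> card (Field r)"
  using assms
proof (induction r rule: finite_poset_induct)
  case (remove r)
  show ?case
  proof (cases "grundy r")
    case (Suc n)
    then obtain v where v: "v \<in> Field r" "grundy (remove r v) = n"
      using less_grundyE[OF remove(1), of n] by auto
    have "Field (remove r v) \<subset> Field r"
      using Field_remove[OF remove(1), of v] finite_poset_Field[OF remove(1)] v(1) by auto
    then have "card (Field (remove r v)) < card (Field r)"
      using remove(1) by (simp add: finite_poset_def psubset_card_mono)
    then show ?thesis
      using remove(2)[OF v(1)] v(2) Suc by simp
  qed simp
qed

section \<open>Winning strategies and Grundy values\<close>

lemma Field_Restr:
  assumes "finite_poset r" "S \<subseteq> Field r"
  shows "Field (Restr r S) = S"
  using assms finite_poset_Field[OF assms(1)] by (auto simp: Field_def)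

lemma finite_poset_Restr:
  assumes "finite_poset r"
  shows "finite_poset (Restr r S)"
  using assms mono_Field[OF Int_lower1, of r "S \<times> S"] unfolding finite_poset_def
  by (auto intro: finite_subset Partial_order_Restr)

text \<open>The bridge between positions as subsets, used by strategies, and positions as posets,
  used by \<open>grundy\<close>.\<close>

lemma remove_Restr: "v \<in> S \<Longrightarrow> remove (Restr r S) v = Restr r (move r S v)"
  by (auto simp: remove_def move_def)

lemma grundy_Restr_eq_0_iff:
  assumes "finite_poset r" "S \<subseteq> Field r"
  shows "grundy (Restr r S) = 0 \<longleftrightarrow> (\<forall>v \<in> S. grundy (Restr r (move r S v)) \<noteq> 0)"
  using grundy_eq_0_iff[OF finite_poset_Restr[OF assms(1)], of S]
  by (simp add: Field_Restr[OF assms] remove_Restr)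

lemma first_player_win_iff_grundy:
  assumes "finite_poset r"
  shows "first_player_win r \<longleftrightarrow> grundy r \<noteq> 0"
proof
  have r: "Restr r (Field r) = r"
    by (auto intro: FieldI1 FieldI2)
  have sub: "move r S v \<subseteq> S" for S v
    by (auto simp: move_def)
  show "grundy r \<noteq> 0" if win: "first_player_win r"
  proof
    assume "grundy r = 0"
    obtain \<sigma> where \<sigma>: "\<And>S. S \<in> first_turns r \<sigma> \<Longrightarrow> \<sigma> S \<in> S"
      using win by (auto simp: first_player_win_def)
    \<comment> \<open>From value 0 the move of \<open>\<sigma>\<close> leads to a nonzero value, and
      some reply restores 0 on a smaller position that is again in \<open>first_turns\<close>; the
      induction hypothesis excludes this. The initial position then gives the contradiction.\<close>
    have "grundy (Restr r S) \<noteq> 0" if "S \<in> first_turns r \<sigma>" "S \<subseteq> Field r" for S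
      using that
    proof (induction "card S" arbitrary: S rule: less_induct)
      case less
      have fin: "finite S"
        using less.prems assms finite_subset by (auto simp: finite_poset_def)
      show ?case
      proof
        assume 0: "grundy (Restr r S) = 0"
        let ?T = "move r S (\<sigma> S)"
        have \<sigma>S: "\<sigma> S \<in> S"
          using \<sigma> less.prems by blast
        have "grundy (Restr r ?T) \<noteq> 0"
          using 0 grundy_Restr_eq_0_iff[OF assms less.prems(2)] \<sigma>S by blast
        moreover have T: "?T \<subseteq> Field r"
          using sub less.prems by blast
        ultimately obtain w where w: "w \<in> ?T" "grundy (Restr r (move r ?T w)) = 0"
          using grundy_Restr_eq_0_iff[OF assms T] by auto
        have "w \<notin> move r ?T w"
          using w T finite_poset_Field[OF assms] by (auto simp: move_def)
        then have "move r ?T w \<subset> S"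
          using w sub by (metis psubsetI subset_trans subsetD)
        then have "card (move r ?T w) < card S"
          using fin by (simp add: psubset_card_mono)
        then show False
          using less.hyps first_turns.round[OF less.prems(1) \<sigma>S w(1)] w(2) T sub by blast
      qed
    qed
    then show False
      using first_turns.start[of r \<sigma>] r \<open>grundy r = 0\<close> by fastforce
  qed
  show "first_player_win r" if "grundy r \<noteq> 0"
  proof -
    \<comment> \<open>The winning strategy moves to value 0. Such a move exists at every nonzero
      position, and the first player only ever meets nonzero positions.\<close>
    define \<sigma> where "\<sigma> S = (SOME v. v \<in> S \<and> grundy (Restr r (move r S v)) = 0)" for S
    have \<sigma>: "\<sigma> S \<in> S \<and> grundy (Restr r (move r S (\<sigma> S))) = 0"
      if "S \<subseteq> Field r" "grundy (Restr r S) \<noteq> 0" for S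
    proof -
      have "\<exists>v. v \<in> S \<and> grundy (Restr r (move r S v)) = 0"
        using that grundy_Restr_eq_0_iff[OF assms that(1)] by auto
      then show ?thesis
        unfolding \<sigma>_def by (rule someI_ex)
    qed
    have "S \<subseteq> Field r \<and> grundy (Restr r S) \<noteq> 0" if "S \<in> first_turns r \<sigma>" for S
      using that
    proof induction
      case start
      then show ?case
        using r \<open>grundy r \<noteq> 0\<close> by simp
    next
      case (round S w)
      let ?T = "move r S (\<sigma> S)"
      have "?T \<subseteq> Field r" "grundy (Restr r ?T) = 0"
        using \<sigma>[of S] sub[of S "\<sigma> S"] round.IH by auto
      then show ?case
        using grundy_Restr_eq_0_iff[of r ?T] assms round.hyps(3) sub[of ?T w] by auto
    qed
    then show ?thesis
      unfolding first_player_win_def using \<sigma> by blast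
  qed
qed

section \<open>Invariance under relabelling\<close>

lemma Field_map_prod: "Field (map_prod h h ` r) = h ` Field r"
  by (force simp: Field_def)

text \<open>An injective relabelling commutes with \<open>remove\<close>, so options correspond one
  to one. It is used to bring the elements into the form \<open>{..<m}\<close> demanded by the
  encoding.\<close>

lemma grundy_image:
  assumes "finite_poset r" "inj_on h (Field r)"
  shows "grundy (map_prod h h ` r) = grundy r" "finite_poset (map_prod h h ` r)"
proof -
  have poset: "finite_poset (map_prod h h ` r)" if "finite_poset r" "inj_on h (Field r)" for r
  proof (rule finite_posetI)
    note h = inj_onD[OF that(2)]
    show "finite (map_prod h h ` r)"
      using finite_poset_finite[OF that(1)] by simp
    show "(x, x) \<in> map_prod h h ` r \<and> (y, y) \<in> map_prod h h ` r" if "(x, y) \<in> map_prod h h ` r" for x y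
      using that finite_poset_Field[OF \<open>finite_poset r\<close>] by (auto dest: FieldI1 FieldI2)
    show "trans (map_prod h h ` r)"
      using finite_poset_trans[OF that(1)] h unfolding trans_def
      by (clarsimp simp: image_iff) (metis FieldI1 FieldI2 map_prod_simp)
    show "antisym (map_prod h h ` r)"
      using finite_poset_antisym[OF that(1)] h unfolding antisym_def
      by (clarsimp simp: image_iff) (metis FieldI1 FieldI2)
  qed
  show "finite_poset (map_prod h h ` r)"
    using poset assms by blast
  show "grundy (map_prod h h ` r) = grundy r"
    using assms
  proof (induction r rule: finite_poset_induct)
    case (remove r)
    note h = inj_onD[OF remove(3)]
    have "remove (map_prod h h ` r) (h v) = map_prod h h ` remove r v" if "v \<in> Field r" for v
    proof -
      have iff: "(h v, h a) \<in> map_prod h h ` r \<longleftrightarrow> (v, a) \<in> r" if "a \<in> Field r" for a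
      proof
        assume "(h v, h a) \<in> map_prod h h ` r"
        then obtain v' a' where "(v', a') \<in> r" "h v = h v'" "h a = h a'"
          by auto
        then show "(v, a) \<in> r"
          using h[of v v'] h[of a a'] \<open>v \<in> Field r\<close> that by (metis FieldI1 FieldI2)
      qed force
      have "(x, y) \<in> remove (map_prod h h ` r) (h v) \<longleftrightarrow> (x, y) \<in> map_prod h h ` remove r v" for x y
      proof -
        \<comment> \<open>Moves the conditions on \<open>x\<close> and \<open>y\<close> to
          preimages, where \<open>iff\<close> can be applied.\<close>
        have ex: "(x, y) \<in> map_prod h h ` r \<and> P x \<and> P y \<longleftrightarrow>
          (\<exists>a b. (a, b) \<in> r \<and> x = h a \<and> y = h b \<and> P (h a) \<and> P (h b))" for P
          by force
        have "(x, y) \<in> remove (map_prod h h ` r) (h v) \<longleftrightarrow>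
          (\<exists>a b. (a, b) \<in> r \<and> x = h a \<and> y = h b \<and> (h v, h a) \<notin> map_prod h h ` r \<and> (h v, h b) \<notin> map_prod h h ` r)"
          using ex[of "\<lambda>x. (h v, x) \<notin> map_prod h h ` r"] unfolding remove_def mem_Collect_eq prod.case by (simp only:)
        also have "\<dots> \<longleftrightarrow> (\<exists>a b. (a, b) \<in> r \<and> x = h a \<and> y = h b \<and> (v, a) \<notin> r \<and> (v, b) \<notin> r)"
          by (intro ex_cong1 conj_cong refl arg_cong[of _ _ Not]) (metis iff FieldI1 FieldI2)+
        also have "\<dots> \<longleftrightarrow> (x, y) \<in> map_prod h h ` remove r v"
          unfolding remove_def by force
        finally show ?thesis .
      qed
      then show ?thesis
        by (auto simp only: set_eq_iff split_paired_All)
    qed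
    then have eq: "grundy (remove (map_prod h h ` r) (h v)) = grundy (remove r v)" if "v \<in> Field r" for v
      using remove.IH[OF that] that remove.prems Field_remove[OF remove.hyps, of v]
      by (metis Diff_subset inj_on_subset)
    show ?case
    proof (rule grundy_eqI)
      show "finite_poset (map_prod h h ` r)"
        using poset remove by blast
      show "grundy (remove (map_prod h h ` r) v) \<noteq> grundy r" if "v \<in> Field (map_prod h h ` r)" for v
        using that by (auto simp: Field_map_prod eq grundy_remove_neq[OF remove(1)])
      show "\<exists>v \<in> Field (map_prod h h ` r). grundy (remove (map_prod h h ` r) v) = k" if "k < grundy r" for k
        by (rule less_grundyE[OF remove(1) that]) (auto simp: Field_map_prod eq)
    qed
  qed
qed

section \<open>Grundy values of the constructions\<close>

lemma beside_iff:
  "(x, y) \<in> beside r s \<longleftrightarrow>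
    even x = even y \<and> (x div 2, y div 2) \<in> (if even x then r else s)"
  unfolding beside_def by (auto elim!: evenE oddE simp: Suc_double_not_eq_double double_not_eq_Suc_double)

lemma beside_eq_Un: "beside r s =
    map_prod (\<lambda>a. 2 * a) (\<lambda>a. 2 * a) ` r \<union> map_prod (\<lambda>a. Suc (2 * a)) (\<lambda>a. Suc (2 * a)) ` s"
  unfolding beside_def by (intro arg_cong2[of _ _ _ _ "(\<union>)"]) force+

lemma Field_beside: "Field (beside r s) = (\<lambda>a. 2 * a) ` Field r \<union> (\<lambda>a. Suc (2 * a)) ` Field s"
  by (simp add: beside_eq_Un Field_Un Field_map_prod)

lemma finite_poset_beside:
  assumes "finite_poset r" "finite_poset s"
  shows "finite_poset (beside r s)"
proof (rule finite_posetI)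
  show "finite (beside r s)"
    using assms[THEN finite_poset_finite] by (simp add: beside_eq_Un)
  show "(a, a) \<in> beside r s \<and> (b, b) \<in> beside r s" if "(a, b) \<in> beside r s" for a b
    using that assms[THEN finite_poset_Field] unfolding beside_iff
    by (auto split: if_splits dest: FieldI1 FieldI2)
  show "trans (beside r s)"
    using assms[THEN finite_poset_trans] unfolding trans_def beside_iff
    by (auto split: if_splits; blast)
  show "antisym (beside r s)"
    using assms[THEN finite_poset_antisym] unfolding antisym_def beside_iff
    by (auto split: if_splits; metis dvd_div_eq_iff odd_two_times_div_two_succ)
qed

lemma card_Field_beside:
  assumes "finite_poset r" "finite_poset s"
  shows "card (Field (beside r s)) = card (Field r) + card (Field s)"
proof -
  have "(\<lambda>a. 2 * a) ` Field r \<inter> (\<lambda>a. Suc (2 * a)) ` Field s = {}"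
    by (auto; presburger)
  then show ?thesis
    using assms unfolding Field_beside finite_poset_def
    by (subst card_Un_disjoint) (auto simp: card_image inj_on_def)
qed

lemma remove_beside:
  "remove (beside r s) (2 * v) = beside (remove r v) s"
  "remove (beside r s) (Suc (2 * v)) = beside r (remove s v)"
  unfolding remove_def by (auto simp: beside_iff)

lemma xor_nat_div_2: "xor m n div 2 = xor (m div 2) (n div 2)" for m n :: nat
  using drop_bit_xor[of 1 m n] by (simp add: drop_bit_eq_div)

lemma xor_left_cancel_nat: "xor m (xor m n) = n" for m n :: nat
  by (simp flip: xor.assoc)

lemma even_xor_nat: "even (xor m n) \<longleftrightarrow> even m = even n" for m n :: nat
  by (simp add: even_xor_iff)

text \<open>The last binary digit is only a tie-breaker; this drives the digitwise induction on
  \<open>xor\<close>.\<close>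

lemma nat_less_div_2_iff:
  "m < n \<longleftrightarrow> m div 2 < n div 2 \<or> m div 2 = n div 2 \<and> even m \<and> odd n" for m n :: nat
  by presburger

text \<open>The number-theoretic core of nim addition. At the highest digit where \<open>z\<close>
  and \<open>xor x y\<close> differ, the latter has a 1, so exactly one of \<open>x\<close> and
  \<open>y\<close> has a 1 there; this one can be lowered to produce \<open>z\<close>.\<close>

lemma less_xor_nat_cases:
  fixes x y z :: nat
  assumes "z < xor x y"
  shows "xor z y < x \<or> xor z x < y"
  using assms
proof (induction z arbitrary: x y rule: less_induct)
  case (less z)
  show ?case
  proof (cases "z div 2 < xor x y div 2")
    case True
    then have *: "z div 2 < xor (x div 2) (y div 2)"
      by (simp add: xor_nat_div_2)
    have "xor (z div 2) (y div 2) < x div 2 \<or> xor (z div 2) (x div 2) < y div 2"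
    proof (cases "z = 0")
      case True
      with * show ?thesis
        by (cases "x div 2" "y div 2" rule: linorder_cases) auto
    next
      case False
      then show ?thesis
        using less.IH[OF _ *] by simp
    qed
    then show ?thesis
      by (auto simp: nat_less_div_2_iff[of "xor z _"] xor_nat_div_2)
  next
    case False
    \<comment> \<open>The difference lies in the last digit only: the odd one of \<open>x\<close>
      and \<open>y\<close> gets lowered by one.\<close>
    then have z: "z div 2 = xor (x div 2) (y div 2)" "even z" "odd x \<noteq> odd y"
      using less.prems nat_less_div_2_iff[of z "xor x y"] by (auto simp: xor_nat_div_2 even_xor_nat)
    have "xor (z div 2) (y div 2) = x div 2" "xor (z div 2) (x div 2) = y div 2"
      unfolding z(1) by (simp_all add: ac_simps xor_left_cancel_nat)
    then show ?thesis
      using z(2,3) by (auto simp: nat_less_div_2_iff[of "xor z _"] xor_nat_div_2 even_xor_nat)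
  qed
qed

lemma xor_nat_cancel: "xor m k = xor n k \<longleftrightarrow> m = n" "xor k m = xor k n \<longleftrightarrow> m = n" for m n k :: nat
  by (metis xor.assoc xor.commute xor_self_eq xor.right_neutral)+

text \<open>A move changes exactly one argument of \<open>xor\<close>, hence its result, and
  \<open>less_xor_nat_cases\<close> tells in which component to move for a smaller value. The
  induction is nested because either component may shrink while the other stays.\<close>

lemma grundy_beside:
  assumes "finite_poset r" "finite_poset s"
  shows "grundy (beside r s) = xor (grundy r) (grundy s)"
  using assms
proof (induction r arbitrary: s rule: finite_poset_induct)
  case (remove r)
  note r = remove.hyps and IHr = remove.IH
  show ?case
    using remove.prems
  proof (induction s rule: finite_poset_induct)
    case (remove s)
    note s = remove.hyps
    have opt: "grundy (remove (beside r s) (2 * v)) = xor (grundy (remove r v)) (grundy s)" if "v \<in> Field r" for v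
      using IHr[OF that s] by (simp add: remove_beside)
    have opt': "grundy (remove (beside r s) (Suc (2 * v))) = xor (grundy r) (grundy (remove s v))"
      if "v \<in> Field s" for v
      using remove.IH[OF that] by (simp add: remove_beside)
    show ?case
    proof (rule grundy_eqI)
      show "finite_poset (beside r s)"
        using r s by (rule finite_poset_beside)
      show "grundy (remove (beside r s) v) \<noteq> xor (grundy r) (grundy s)" if "v \<in> Field (beside r s)" for v
        using that opt opt' grundy_remove_neq[OF r] grundy_remove_neq[OF s]
        by (auto simp: Field_beside xor_nat_cancel)
      fix k
      assume k: "k < xor (grundy r) (grundy s)"
      have *: "xor (xor k m) m = k" "xor m (xor k m) = k" for m
        by (simp_all add: ac_simps xor_left_cancel_nat)
      from less_xor_nat_cases[OF k]
      show "\<exists>v \<in> Field (beside r s). grundy (remove (beside r s) v) = k"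
      proof
        assume "xor k (grundy s) < grundy r"
        from less_grundyE[OF r this] obtain v where "v \<in> Field r" "grundy (remove r v) = xor k (grundy s)" .
        then show ?thesis
          using opt[of v] * by (auto simp: Field_beside)
      next
        assume "xor k (grundy r) < grundy s"
        from less_grundyE[OF s this] obtain v where "v \<in> Field s" "grundy (remove s v) = xor k (grundy r)" .
        then show ?thesis
          using opt'[of v] * by (auto simp: Field_beside)
      qed
    qed
  qed
qed

section \<open>Bottom vertices and towers\<close>

lemma add_bottom_iff:
  "(x, y) \<in> add_bottom r \<longleftrightarrow>
    (case (x, y) of (0, 0) \<Rightarrow> True | (0, Suc b) \<Rightarrow> b \<in> Field r | (Suc a, 0) \<Rightarrow> False | (Suc a, Suc b) \<Rightarrow> (a, b) \<in> r)"
  unfolding add_bottom_def by (auto split: nat.splits)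

lemma Field_add_bottom: "Field (add_bottom r) = insert 0 (Suc ` Field r)"
  unfolding add_bottom_def by (force simp: Field_def)

lemma finite_poset_add_bottom:
  assumes "finite_poset r"
  shows "finite_poset (add_bottom r)"
proof (rule finite_posetI)
  have "finite (Field (add_bottom r))"
    using assms by (simp add: Field_add_bottom finite_poset_def)
  then have "finite (Field (add_bottom r) \<times> Field (add_bottom r))"
    by simp
  then show "finite (add_bottom r)"
    by (rule rev_finite_subset) (auto intro: FieldI1 FieldI2)
  show "(a, a) \<in> add_bottom r \<and> (b, b) \<in> add_bottom r" if "(a, b) \<in> add_bottom r" for a b
    using that finite_poset_Field[OF assms] by (auto simp: add_bottom_iff split: nat.splits dest: FieldI1 FieldI2)
  show "trans (add_bottom r)"
    using finite_poset_trans[OF assms] unfolding trans_def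
    by (auto simp: add_bottom_iff split: nat.splits dest: FieldI2)
  show "antisym (add_bottom r)"
    using finite_poset_antisym[OF assms] unfolding antisym_def
    by (auto simp: add_bottom_iff split: nat.splits)
qed

lemma card_Field_add_bottom:
  "finite_poset r \<Longrightarrow> card (Field (add_bottom r)) = Suc (card (Field r))"
  by (simp add: Field_add_bottom finite_poset_def card_image)

lemma remove_add_bottom:
  assumes "finite_poset r"
  shows "remove (add_bottom r) 0 = {}" "v \<in> Field r \<Longrightarrow> remove (add_bottom r) (Suc v) = add_bottom (remove r v)"
proof -
  show "remove (add_bottom r) 0 = {}"
    by (auto simp: remove_def add_bottom_iff split: nat.splits dest: FieldI1 FieldI2)
  show "remove (add_bottom r) (Suc v) = add_bottom (remove r v)" if "v \<in> Field r"
  proof (rule subset_antisym; rule subrelI)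
    fix x y
    show "(x, y) \<in> add_bottom (remove r v)" if "(x, y) \<in> remove (add_bottom r) (Suc v)"
      using that by (cases x; cases y) (auto simp: remove_iff add_bottom_iff Field_remove[OF assms])
    show "(x, y) \<in> remove (add_bottom r) (Suc v)" if "(x, y) \<in> add_bottom (remove r v)"
      using that by (cases x; cases y) (auto simp: remove_iff add_bottom_iff Field_remove[OF assms])
  qed
qed

lemma grundy_empty [simp]: "grundy {} = 0"
  by (subst grundy.simps) simp

text \<open>Choosing the bottom clears the board and gives 0; any other move keeps the bottom, so
  the option values of \<open>r\<close> appear shifted by one.\<close>

lemma grundy_add_bottom:
  assumes "finite_poset r"
  shows "grundy (add_bottom r) = Suc (grundy r)"
  using assms
proof (induction r rule: finite_poset_induct)
  case (remove r)
  note opt = remove_add_bottom[OF remove(1)]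
  show ?case
  proof (rule grundy_eqI)
    show "finite_poset (add_bottom r)"
      by (rule finite_poset_add_bottom) fact
    show "grundy (remove (add_bottom r) v) \<noteq> Suc (grundy r)" if "v \<in> Field (add_bottom r)" for v
      using that opt remove(2) grundy_remove_neq[OF remove(1)] by (auto simp: Field_add_bottom)
    show "\<exists>v \<in> Field (add_bottom r). grundy (remove (add_bottom r) v) = k" if "k < Suc (grundy r)" for k
    proof (cases k)
      case 0
      then show ?thesis
        using opt by (auto simp: Field_add_bottom)
    next
      case (Suc m)
      with that obtain v where "v \<in> Field r" "grundy (remove r v) = m"
        using less_grundyE[OF remove(1), of m] by auto
      then show ?thesis
        using opt remove(2) Suc by (auto simp: Field_add_bottom)
    qed
  qed
qed

lemma add_bottoms:
  assumes "finite_poset r"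
  shows "finite_poset ((add_bottom ^^ n) r) \<and> grundy ((add_bottom ^^ n) r) = grundy r + n
    \<and> card (Field ((add_bottom ^^ n) r)) = card (Field r) + n"
  by (induction n) (auto simp: assms finite_poset_add_bottom grundy_add_bottom card_Field_add_bottom)

lemma Field_tower: "Field (tower x) = {..<x}"
  by (auto simp: Field_def tower_def)

lemma finite_poset_tower: "finite_poset (tower x)"
proof (rule finite_posetI)
  show "finite (tower x)"
    by (rule finite_subset[of _ "{..<x} \<times> {..<x}"]) (auto simp: tower_def)
qed (auto simp: tower_def trans_def antisym_def)

text \<open>Choosing element \<open>v\<close> of a chain leaves the chain below it,
  \<open>tower v\<close>, so the option values are exactly the numbers below
  \<open>x\<close>.\<close>

lemma grundy_tower: "grundy (tower x) = x"
proof (induction x rule: less_induct)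
  case (less x)
  have "remove (tower x) v = tower v" if "v < x" for v
    using that by (auto simp: tower_def remove_def)
  with less show ?case
    by (intro grundy_eqI finite_poset_tower) (auto simp: Field_tower)
qed

lemma Field_subsetI: "r \<subseteq> A \<times> A \<Longrightarrow> Field r \<subseteq> A"
  by (auto simp: Field_def)

section \<open>The OR construction\<close>

lemma or_game_iff:
  "(x, y) \<in> or_game A B \<longleftrightarrow> (x, y) \<in> beside A B \<or> even x \<and> odd y \<and> x div 2 \<in> Field A \<and> y div 2 \<in> Field B"
  unfolding or_game_def by (auto elim!: evenE oddE simp: Suc_double_not_eq_double double_not_eq_Suc_double)

lemma Field_or_game: "Field (or_game A B) = Field (beside A B)"
proof -
  have "{(2 * a, 2 * b + 1) | a b. a \<in> Field A \<and> b \<in> Field B} \<subseteq> Field (beside A B) \<times> Field (beside A B)"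
    unfolding Field_beside by auto
  then have "Field {(2 * a, 2 * b + 1) | a b. a \<in> Field A \<and> b \<in> Field B} \<subseteq> Field (beside A B)"
    by (rule Field_subsetI)
  then show ?thesis
    unfolding or_game_def by (auto simp: Field_Un)
qed

lemma finite_poset_or_game:
  assumes "finite_poset r" "finite_poset s"
  shows "finite_poset (or_game r s)"
proof (rule finite_posetI)
  note b = finite_poset_beside[OF assms]
  have "finite (Field (or_game r s) \<times> Field (or_game r s))"
    using b by (simp add: Field_or_game finite_poset_def)
  then show "finite (or_game r s)"
    by (rule rev_finite_subset) (auto intro: FieldI1 FieldI2)
  show "(x, x) \<in> or_game r s \<and> (y, y) \<in> or_game r s" if "(x, y) \<in> or_game r s" for x y
    using that assms[THEN finite_poset_Field] unfolding or_game_iff beside_iff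
    by (auto split: if_splits dest: FieldI1 FieldI2)
  show "trans (or_game r s)"
    using assms[THEN finite_poset_trans] unfolding trans_def or_game_iff beside_iff
    by (auto split: if_splits dest: FieldI1 FieldI2; blast)
  show "antisym (or_game r s)"
    using finite_poset_antisym[OF b] unfolding antisym_def or_game_iff
    by (auto simp: beside_iff split: if_splits)
qed

text \<open>A move in the lower part wipes out the upper part; \<open>beside _ {}\<close> only
  records that the surviving elements keep their even numbers.\<close>

lemma remove_or_game:
  assumes "finite_poset r" "finite_poset s"
  shows "v \<in> Field r \<Longrightarrow> remove (or_game r s) (2 * v) = beside (remove r v) {}"
    and "v \<in> Field s \<Longrightarrow> remove (or_game r s) (Suc (2 * v)) = or_game r (remove s v)"
proof -
  show "remove (or_game r s) (2 * v) = beside (remove r v) {}" if "v \<in> Field r"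
    using that by (auto simp: remove_iff or_game_iff beside_iff split: if_splits dest: FieldI1 FieldI2)
  show "remove (or_game r s) (Suc (2 * v)) = or_game r (remove s v)" if "v \<in> Field s"
    using that by (auto simp: remove_iff or_game_iff beside_iff Field_remove[OF assms(2)] split: if_splits)
qed

lemma finite_poset_empty: "finite_poset {}"
  by (rule finite_posetI) (simp_all add: trans_def antisym_def)

text \<open>If \<open>r\<close> has a move to 0, that move wins since it also discards
  \<open>s\<close>. Otherwise moves in \<open>r\<close> lose, and moves in \<open>s\<close> lead to
  a smaller OR covered by the induction hypothesis.\<close>

lemma grundy_or_game_eq_0_iff:
  assumes "finite_poset r" "finite_poset s"
  shows "grundy (or_game r s) = 0 \<longleftrightarrow> grundy r = 0 \<and> grundy s = 0"
  using assms(2)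
proof (induction s rule: finite_poset_induct)
  case (remove s)
  have "grundy (or_game r s) = 0 \<longleftrightarrow>
    (\<forall>v \<in> Field r. grundy (remove r v) \<noteq> 0) \<and> (\<forall>v \<in> Field s. grundy (or_game r (remove s v)) \<noteq> 0)"
    by (simp add: grundy_eq_0_iff[OF finite_poset_or_game[OF assms(1) remove(1)]] Field_or_game Field_beside
        ball_Un remove_or_game[OF assms(1) remove(1)] grundy_beside finite_poset_remove[OF assms(1)] finite_poset_empty)
  also have "\<dots> \<longleftrightarrow> (\<forall>v \<in> Field r. grundy (remove r v) \<noteq> 0) \<and>
      (\<forall>v \<in> Field s. \<not> (grundy r = 0 \<and> grundy (remove s v) = 0))"
    by (intro arg_cong2[of _ _ _ _ "(\<and>)"] ball_cong refl) (simp only: remove.IH)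
  also have "\<dots> \<longleftrightarrow> grundy r = 0 \<and> grundy s = 0"
    using grundy_eq_0_iff[OF assms(1)] grundy_eq_0_iff[OF remove(1)] by auto
  finally show ?case .
qed

subsection \<open>Negation\<close>

lemma bottoms_and_tower:
  assumes "finite_poset r"
  shows "finite_poset (bottoms_and_tower k r)"
    and "grundy (bottoms_and_tower k r) = xor (grundy r + 2 ^ k) (2 ^ k)"
    and "card (Field (bottoms_and_tower k r)) = card (Field r) + 2 * 2 ^ k"
  using add_bottoms[OF assms, of "2 ^ k"] finite_poset_tower[of "2 ^ k"] unfolding bottoms_and_tower_def
  by (simp_all add: finite_poset_beside grundy_beside card_Field_beside grundy_tower Field_tower)

text \<open>Adding \<open>2 ^ k\<close> toggles bit \<open>k\<close> and carries exactly if that bit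
  was set; \<open>xor\<close> toggles it back, so only the carry remains. The induction strips the
  last binary digit.\<close>

lemma add_xor_power_of_2:
  fixes v :: nat
  shows "xor (v + 2 ^ k) (2 ^ k) = v + (if bit v k then 2 ^ Suc k else 0)"
proof (induction k arbitrary: v)
  case 0
  show ?case
    by (auto simp: xor_Suc_0_eq bit_0 elim!: evenE oddE)
next
  case (Suc k)
  have "(v + 2 * 2 ^ k) div 2 = v div 2 + 2 ^ k"
    by simp
  then have "xor (v + 2 ^ Suc k) (2 ^ Suc k) = of_bool (odd v) + 2 * xor (v div 2 + 2 ^ k) (2 ^ k)"
    by (subst xor_rec) (simp add: add.commute)
  also have "\<dots> = v + (if bit v (Suc k) then 2 ^ Suc (Suc k) else 0)"
    unfolding Suc.IH bit_Suc by (auto elim!: evenE oddE)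
  finally show ?case .
qed

text \<open>The game held by the loop of \<open>not_game\<close> after \<open>k\<close>
  rounds.\<close>

primrec flip :: "nat \<Rightarrow> nat rel \<Rightarrow> nat rel" where
  "flip 0 G = G"
| "flip (Suc k) G = bottoms_and_tower k (flip k G)"

text \<open>Round \<open>j\<close> adds \<open>2 ^ (j + 1)\<close> iff bit \<open>j\<close> is set,
  and no later round touches bit \<open>j\<close>. So the total increase is twice the number formed
  by the low \<open>k\<close> bits of the final value. Adding 2 in the size equation avoids
  truncated subtraction.\<close>

lemma flip:
  assumes "finite_poset G"
  shows finite_poset_flip: "finite_poset (flip k G)"
    and card_Field_flip: "card (Field (flip k G)) + 2 = card (Field G) + 2 * 2 ^ k"
    and grundy_flip: "grundy (flip k G) = grundy G + 2 * (grundy (flip k G) mod 2 ^ k)"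
proof -
  have fp: "finite_poset (flip k G)" for k
    by (induction k) (simp_all add: assms bottoms_and_tower(1))
  then show "finite_poset (flip k G)" .
  show "card (Field (flip k G)) + 2 = card (Field G) + 2 * 2 ^ k"
    by (induction k) (simp_all add: bottoms_and_tower(3) fp)
  show "grundy (flip k G) = grundy G + 2 * (grundy (flip k G) mod 2 ^ k)"
  proof (induction k)
    case (Suc k)
    let ?v = "grundy (flip k G)"
    have "?v mod 2 ^ Suc k = ?v mod 2 ^ k + (if bit ?v k then 2 ^ k else 0)"
      using take_bit_Suc_from_most[of k ?v] by (simp add: take_bit_eq_mod del: power_Suc)
    moreover have "grundy (flip (Suc k) G) = ?v + (if bit ?v k then 2 ^ Suc k else 0)"
      by (simp add: bottoms_and_tower(2) fp add_xor_power_of_2)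
    ultimately show ?case
      using Suc by auto
  qed simp
qed

text \<open>The value of the counter when the NOT loop stops.\<close>

definition bit_length :: "nat \<Rightarrow> nat" where
  "bit_length g = (LEAST i. g < 2 ^ i)"

lemma less_power_bit_length: "g < 2 ^ bit_length g"
  unfolding bit_length_def by (rule LeastI[of _ g]) (rule less_exp)

lemma power_le_of_less_bit_length: "i < bit_length g \<Longrightarrow> 2 ^ i \<le> g"
  unfolding bit_length_def using not_less_Least by (metis not_le)

lemma power_bit_length_le:
  assumes "0 < g"
  shows "2 ^ bit_length g \<le> 2 * g"
proof (cases "bit_length g")
  case 0
  then show ?thesis
    using assms by simp
next
  case (Suc i)
  then show ?thesis
    using power_le_of_less_bit_length[of i g] by simp
qed

text \<open>Skips rounds whose guard is known to hold; unfolding once more at a state violating the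
  guard then yields the result of the loop.\<close>

lemma while_funpow:
  assumes "\<And>j. j < k \<Longrightarrow> b ((c ^^ j) s)"
  shows "while b c s = while b c ((c ^^ k) s)"
  using assms
proof (induction k)
  case (Suc k)
  have "while b c ((c ^^ k) s) = while b c (c ((c ^^ k) s))"
    by (subst while_unfold) (simp add: Suc.prems)
  with Suc show ?case
    by simp
qed simp

text \<open>Separating the round count from \<open>G\<close> allows one fixed count for a whole
  family of games of equal size.\<close>

definition not_game_at :: "nat \<Rightarrow> nat rel \<Rightarrow> nat rel" where
  "not_game_at i G = beside (beside (flip i G) (flip (Suc i) G)) (tower (2 ^ Suc i))"

lemma not_game_eq: "not_game G = not_game_at (bit_length (card (Field G))) G"
proof -
  let ?i = "bit_length (card (Field G))"
  let ?b = "\<lambda>(i :: nat, H :: nat rel). 2 ^ i \<le> card (Field G)"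
  let ?c = "\<lambda>(i, H). (i + 1, bottoms_and_tower i H)"
  have funpow: "(?c ^^ j) (0, G) = (j, flip j G)" for j
    by (induction j) simp_all
  have "while ?b ?c (0, G) = while ?b ?c ((?c ^^ ?i) (0, G))"
    by (rule while_funpow) (simp only: funpow prod.case power_le_of_less_bit_length)
  also have "\<dots> = (?i, flip ?i G)"
    unfolding funpow by (subst while_unfold) (simp add: linorder_not_le[THEN iffD2, OF less_power_bit_length])
  finally show ?thesis
    by (simp add: not_game_def not_game_at_def)
qed

lemma finite_poset_not_game: "finite_poset G \<Longrightarrow> finite_poset (not_game G)"
  by (simp add: not_game_eq not_game_at_def finite_poset_beside finite_poset_flip finite_poset_tower del: flip.simps)

text \<open>The exact size is \<open>2 * g + 8 * 2 ^ i - 4\<close>, and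
  \<open>2 ^ i \<le> 2 * g\<close> bounds it by \<open>18 * g\<close>.\<close>

lemma card_Field_not_game:
  assumes "finite_poset G" "0 < card (Field G)"
  shows "0 < card (Field (not_game G))" "card (Field (not_game G)) \<le> 18 * card (Field G)"
proof -
  define g i where "g = card (Field G)" and "i = bit_length g"
  have "card (Field (not_game G)) = card (Field (flip i G)) + card (Field (flip (Suc i) G)) + 2 * 2 ^ i"
    by (simp add: not_game_eq not_game_at_def card_Field_beside finite_poset_beside finite_poset_flip[OF assms(1)]
        finite_poset_tower Field_tower g_def i_def del: flip.simps)
  moreover have "card (Field (flip i G)) + 2 = g + 2 * 2 ^ i" "card (Field (flip (Suc i) G)) + 2 = g + 4 * 2 ^ i"
    using card_Field_flip[OF assms(1), of i] card_Field_flip[OF assms(1), of "Suc i"] by (simp_all add: g_def del: flip.simps)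
  moreover have "(2 :: nat) ^ i \<le> 2 * g" "0 < (2 :: nat) ^ i"
    using power_bit_length_le[of g] assms(2) by (simp_all add: g_def i_def)
  ultimately show "0 < card (Field (not_game G))" "card (Field (not_game G)) \<le> 18 * card (Field G)"
    unfolding g_def[symmetric] by linarith+
qed

text \<open>For \<open>n = 0\<close> both flipped games have value 0 and the tower alone remains.
  Otherwise their values differ exactly in bit \<open>i + 1\<close>, which the tower
  cancels.\<close>

lemma grundy_not_game_eq_0_iff:
  assumes "finite_poset G"
  shows "grundy (not_game G) = 0 \<longleftrightarrow> grundy G \<noteq> 0"
proof -
  define n where "n = grundy G"
  define i where "i = bit_length (card (Field G))"
  define v where "v = grundy (flip i G)"
  have fp: "finite_poset (flip k G)" for k
    by (rule finite_poset_flip[OF assms])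
  have flip_Suc: "grundy (flip (Suc i) G) = v + (if bit v i then 2 ^ Suc i else 0)"
    by (simp add: bottoms_and_tower(2) fp add_xor_power_of_2 v_def)
  have not_game: "grundy (not_game G) = xor (xor v (grundy (flip (Suc i) G))) (2 ^ Suc i)"
    by (simp add: not_game_eq not_game_at_def grundy_beside finite_poset_beside fp finite_poset_tower grundy_tower
        v_def i_def del: flip.simps power_Suc)
  have n: "n < 2 ^ i"
    using grundy_le_card[OF assms] less_power_bit_length[of "card (Field G)"] by (simp add: n_def i_def)
  \<comment> \<open>The right-hand side is below \<open>2 * 2 ^ i\<close>, so the quotient is 0 or
    1, and the two cases below show that it is 0 exactly for \<open>n = 0\<close>.\<close>
  have v: "v div 2 ^ i * 2 ^ i = n + v mod 2 ^ i"
    using grundy_flip[OF assms, of i] div_mult_mod_eq[of v "2 ^ i"] unfolding v_def n_def by linarith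
  show ?thesis
  proof (cases "n = 0")
    case True
    have "v div 2 ^ i = 0"
    proof (rule ccontr)
      assume "v div 2 ^ i \<noteq> 0"
      then have "2 ^ i \<le> v div 2 ^ i * 2 ^ i"
        by simp
      moreover have "v mod 2 ^ i < 2 ^ i"
        by simp
      ultimately show False
        using v True by linarith
    qed
    then have "v = 0"
      using v True div_mult_mod_eq[of v "2 ^ i"] by simp
    then show ?thesis
      using True flip_Suc not_game by (simp add: n_def)
  next
    case False
    have "v mod 2 ^ i < 2 ^ i"
      by simp
    with v n have "v div 2 ^ i * 2 ^ i < 2 * 2 ^ i"
      by linarith
    then have "v div 2 ^ i < 2"
      by (simp only: mult_less_cancel2)
    moreover have "v div 2 ^ i \<noteq> 0"
      using v False by (metis add_is_0 mult_zero_left)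
    ultimately have q: "v div 2 ^ i = 1"
      by linarith
    have "bit v i"
      by (simp add: bit_iff_odd q)
    \<comment> \<open>With bit \<open>i + 1\<close> clear, adding \<open>2 ^ Suc i\<close> causes no
      carry and agrees with \<open>xor\<close>.\<close>
    moreover have "\<not> bit v (Suc i)"
      using q by (simp add: bit_iff_odd power_Suc2 div_mult2_eq del: power_Suc)
    then have "xor (v + 2 ^ Suc i) (2 ^ Suc i) = v"
      using add_xor_power_of_2[of v "Suc i"] by simp
    then have "xor v (v + 2 ^ Suc i) = 2 ^ Suc i"
      by (metis xor_left_cancel_nat xor.commute)
    ultimately show ?thesis
      using not_game flip_Suc False by (simp add: n_def)
  qed
qed

section \<open>Evaluation of circuits\<close>

text \<open>Keeps all intermediate values, of which \<open>out_val\<close> returns the last, so that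
  induction over gate positions is possible.\<close>

definition gate_vals :: "('v list \<Rightarrow> 'g \<Rightarrow> 'v) \<Rightarrow> 'g list \<Rightarrow> 'v list" where
  "gate_vals f C = foldl (\<lambda>vs g. vs @ [f vs g]) [] C"

lemma length_gate_vals [simp]: "length (gate_vals f C) = length C"
  by (induction C rule: rev_induct) (simp_all add: gate_vals_def)

lemma gate_vals_nth:
  "i < length C \<Longrightarrow> gate_vals f C ! i = f (take i (gate_vals f C)) (C ! i)"
proof (induction C rule: rev_induct)
  case (snoc g C)
  have "gate_vals f (C @ [g]) = gate_vals f C @ [f (gate_vals f C) g]"
    by (simp add: gate_vals_def)
  with snoc show ?case
    by (cases "i = length C") (simp_all add: nth_append)
qed simp

lemma out_val_eq: "C \<noteq> [] \<Longrightarrow> out_val f C = gate_vals f C ! (length C - 1)"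
  by (metis gate_vals_def last_conv_nth length_0_conv length_gate_vals out_val_def)

lemma out_val_singleton [simp]: "out_val f [g] = f [] g"
  by (simp add: out_val_def)

lemma circuit_gate_induct [consumes 2, case_names gate]:
  assumes "circuit n C" "i < length C"
    and "\<And>i. i < length C \<Longrightarrow> \<forall>j \<in> set (gate_args (C ! i)). j < i \<and> P j \<Longrightarrow>
      (\<And>k. C ! i = InputG k \<Longrightarrow> k < n) \<Longrightarrow> P i"
  shows "P i"
  using assms(2)
proof (induction i rule: less_induct)
  case (less i)
  show ?case
  proof (rule assms(3)[OF less.prems])
    show "\<forall>j \<in> set (gate_args (C ! i)). j < i \<and> P j"
      using assms(1) less by (auto simp: circuit_def)
    show "k < n" if "C ! i = InputG k" for k
      using assms(1) less.prems that by (metis circuit_def nth_mem)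
  qed
qed

text \<open>For \<open>k = 1\<close> this is the prescribed variable game; for \<open>k = 2\<close>
  both truth values have the same two elements, as the reduction requires.\<close>

definition leaf :: "nat \<Rightarrow> bool \<Rightarrow> nat rel" where
  "leaf k b = (if b then tower k else beside (tower 1) (tower 1))"

definition padded_gate_game :: "nat \<Rightarrow> bool list \<Rightarrow> nat rel list \<Rightarrow> gate \<Rightarrow> nat rel" where
  "padded_gate_game k x vs g =
    (case g of InputG j \<Rightarrow> leaf k (x ! j) | ConstG b \<Rightarrow> leaf k b | _ \<Rightarrow> gate_game x vs g)"

lemma padded_gate_game_simps [simp]:
  "padded_gate_game k x vs (InputG j) = leaf k (x ! j)"
  "padded_gate_game k x vs (ConstG b) = leaf k b"
  "padded_gate_game k x vs (NotG i) = not_game (vs ! i)"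
  "padded_gate_game k x vs (AndG i j) = and_game (vs ! i) (vs ! j)"
  "padded_gate_game k x vs (OrG i j) = or_game (vs ! i) (vs ! j)"
  by (simp_all add: padded_gate_game_def)

lemma var_game_eq_leaf: "var_game b = leaf 1 b"
proof -
  have "tower 1 = {(0, 0)}"
    by (auto simp: tower_def)
  then show ?thesis
    by (simp add: var_game_def leaf_def beside_def insert_commute)
qed

lemma gate_game_eq_padded: "gate_game = padded_gate_game 1"
proof (intro ext)
  show "gate_game x vs g = padded_gate_game 1 x vs g" for x vs g
    by (cases g) (simp_all add: var_game_eq_leaf)
qed

text \<open>The invariant at a gate of depth \<open>d\<close>. Leaves have at most 2 elements, and
  AND is the costliest gate: two nested NOTs around a union give the factor
  \<open>18 * 18 * 2 = 648\<close>. Nonemptiness is carried along for the size bound on NOT.\<close>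

definition represents :: "nat rel \<Rightarrow> bool \<Rightarrow> nat \<Rightarrow> bool" where
  "represents G b d \<longleftrightarrow> finite_poset G \<and> (grundy G \<noteq> 0 \<longleftrightarrow> b) \<and>
    0 < card (Field G) \<and> card (Field G) \<le> 2 * 648 ^ d"

section \<open>Correctness and size gate by gate\<close>

lemma represents_leaf:
  assumes "k \<in> {1, 2}"
  shows "represents (leaf k b) b 0"
  using assms unfolding represents_def leaf_def
  by (auto simp: finite_poset_tower finite_poset_beside grundy_beside grundy_tower card_Field_beside Field_tower)

lemma represents_not:
  assumes "represents G b d"
  shows "represents (not_game G) (\<not> b) (Suc d)"
proof -
  have "card (Field (not_game G)) \<le> 18 * card (Field G)"
    using card_Field_not_game(2) assms by (simp add: represents_def)
  also have "\<dots> \<le> 18 * (2 * 648 ^ d)"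
    using assms by (simp add: represents_def)
  also have "\<dots> \<le> 2 * 648 ^ Suc d"
    by simp
  finally show ?thesis
    using assms card_Field_not_game(1) finite_poset_not_game grundy_not_game_eq_0_iff
    unfolding represents_def by simp
qed

lemma card_Field_or_game:
  "finite_poset A \<Longrightarrow> finite_poset B \<Longrightarrow> card (Field (or_game A B)) = card (Field A) + card (Field B)"
  by (simp add: Field_or_game card_Field_beside)

lemma represents_or:
  assumes "represents A a d" "represents B b e"
  shows "represents (or_game A B) (a \<or> b) (Suc (max d e))"
proof -
  have pow: "(648 :: nat) ^ d \<le> 648 ^ max d e" "(648 :: nat) ^ e \<le> 648 ^ max d e"
    by (simp_all add: power_increasing)
  have "card (Field (or_game A B)) \<le> 2 * 648 ^ d + 2 * 648 ^ e"
    using assms by (simp add: card_Field_or_game represents_def)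
  also have "\<dots> \<le> 2 * 648 ^ Suc (max d e)"
    unfolding power_Suc using pow by linarith
  finally show ?thesis
    using assms by (auto simp: represents_def card_Field_or_game finite_poset_or_game grundy_or_game_eq_0_iff)
qed

lemma represents_and:
  assumes "represents A a d" "represents B b e"
  shows "represents (and_game A B) (a \<and> b) (Suc (max d e))"
proof -
  note not = card_Field_not_game finite_poset_not_game grundy_not_game_eq_0_iff
  note or = card_Field_or_game finite_poset_or_game grundy_or_game_eq_0_iff
  have pow: "(648 :: nat) ^ d \<le> 648 ^ max d e" "(648 :: nat) ^ e \<le> 648 ^ max d e"
    by (simp_all add: power_increasing)
  have fp: "finite_poset A" "finite_poset B" "0 < card (Field A)" "0 < card (Field B)"
    using assms by (simp_all add: represents_def)
  let ?N = "or_game (not_game A) (not_game B)"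
  have N: "finite_poset ?N" "card (Field ?N) = card (Field (not_game A)) + card (Field (not_game B))"
    using fp by (simp_all add: not or)
  then have "0 < card (Field ?N)"
    using fp not(1) by simp
  have "card (Field (and_game A B)) \<le> 18 * card (Field ?N)"
    unfolding and_game_def by (rule not(2)) fact+
  also have "\<dots> \<le> 18 * (18 * card (Field A) + 18 * card (Field B))"
    unfolding N(2) using not(2) fp by (intro mult_left_mono add_mono) auto
  also have "\<dots> \<le> 18 * (18 * (2 * 648 ^ d) + 18 * (2 * 648 ^ e))"
    using assms by (intro mult_left_mono add_mono) (auto simp: represents_def)
  also have "\<dots> = 648 * 648 ^ d + 648 * 648 ^ e"
    by simp
  also have "\<dots> \<le> 2 * 648 ^ Suc (max d e)"
    unfolding power_Suc using pow by linarith
  finally show ?thesis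
    using assms N(1) \<open>0 < card (Field ?N)\<close> not(1)[of ?N] fp
    unfolding represents_def by (auto simp: and_game_def not or)
qed

lemma represents_circuit:
  assumes "circuit n C" "k \<in> {1, 2}"
  shows "represents (out_val (padded_gate_game k x) C) (circuit_eval C x) (circuit_depth C)"
proof -
  let ?G = "gate_vals (padded_gate_game k x) C" and ?E = "gate_vals (gate_eval x) C"
    and ?D = "gate_vals gate_depth C"
  have C: "C \<noteq> []"
    using assms by (simp add: circuit_def)
  have "represents (?G ! i) (?E ! i) (?D ! i)" if "i < length C" for i
    using assms(1) that
  proof (induction rule: circuit_gate_induct)
    case (gate i)
    then show ?case
      by (cases "C ! i")
        (simp_all add: gate_vals_nth[OF gate(1)] represents_leaf[OF assms(2)]
          represents_not represents_or represents_and)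
  qed
  with C show ?thesis
    by (simp add: out_val_eq circuit_eval_def circuit_depth_def)
qed

section \<open>Games whose order relation consists of input bits\<close>

definition input_bit :: "nat \<Rightarrow> (bool list \<Rightarrow> bool) \<Rightarrow> bool" where
  "input_bit n p \<longleftrightarrow> (\<exists>c. \<forall>x. length x = n \<longrightarrow> p x = c) \<or> (\<exists>k<n. \<forall>x. length x = n \<longrightarrow> p x = x ! k)"

text \<open>The element set must not vary with the input, because bottoms, OR and the round count of
  NOT refer to it.\<close>

definition input_game :: "nat \<Rightarrow> (bool list \<Rightarrow> 'a rel) \<Rightarrow> bool" where
  "input_game n R \<longleftrightarrow> (\<exists>F. \<forall>x. length x = n \<longrightarrow> Field (R x) = F) \<and> (\<forall>a b. input_bit n (\<lambda>x. (a, b) \<in> R x))"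

lemma input_bit_const [simp]: "input_bit n (\<lambda>_. c)"
  by (auto simp: input_bit_def)

lemma input_bit_disj: "input_bit n p \<Longrightarrow> input_bit n (\<lambda>x. p x \<or> c)"
  by (cases c) simp_all

lemma input_bit_cong:
  "(\<And>x. length x = n \<Longrightarrow> p x = q x) \<Longrightarrow> input_bit n p = input_bit n q"
  by (simp add: input_bit_def)

lemma input_game_const: "input_game n (\<lambda>_. r)"
  by (simp add: input_game_def)

lemma input_game_cong:
  "(\<And>x. length x = n \<Longrightarrow> R x = S x) \<Longrightarrow> input_game n R = input_game n S"
  by (simp add: input_game_def input_bit_def)

lemma input_gameE:
  assumes "input_game n R"
  obtains F where "\<And>x. length x = n \<Longrightarrow> Field (R x) = F"
  using assms by (auto simp: input_game_def)

lemma input_game_beside: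
  assumes "input_game n R" "input_game n S"
  shows "input_game n (\<lambda>x. beside (R x) (S x))"
proof -
  obtain F F' where F: "\<And>x. length x = n \<Longrightarrow> Field (R x) = F" "\<And>x. length x = n \<Longrightarrow> Field (S x) = F'"
    using assms by (metis input_gameE)
  have "input_bit n (\<lambda>x. (a, b) \<in> beside (R x) (S x))" for a b
    using assms by (cases "even a"; cases "even b") (simp_all add: beside_iff input_game_def)
  moreover have "\<exists>F. \<forall>x. length x = n \<longrightarrow> Field (beside (R x) (S x)) = F"
    by (simp add: Field_beside F)
  ultimately show ?thesis
    by (simp add: input_game_def)
qed

lemma input_game_or_game:
  assumes "input_game n R" "input_game n S"
  shows "input_game n (\<lambda>x. or_game (R x) (S x))"
proof -
  obtain F F' where F: "\<And>x. length x = n \<Longrightarrow> Field (R x) = F" "\<And>x. length x = n \<Longrightarrow> Field (S x) = F'"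
    using assms by (metis input_gameE)
  have "input_bit n (\<lambda>x. (a, b) \<in> or_game (R x) (S x))" for a b
  proof -
    have "input_bit n (\<lambda>x. (a, b) \<in> or_game (R x) (S x)) \<longleftrightarrow>
      input_bit n (\<lambda>x. (a, b) \<in> beside (R x) (S x) \<or> even a \<and> odd b \<and> a div 2 \<in> F \<and> b div 2 \<in> F')"
      by (rule input_bit_cong) (simp add: or_game_iff F)
    also have "\<dots>"
      using input_game_beside[OF assms]
      by (intro input_bit_disj) (simp add: input_game_def)
    finally show ?thesis .
  qed
  moreover have "\<exists>F. \<forall>x. length x = n \<longrightarrow> Field (or_game (R x) (S x)) = F"
    by (simp add: Field_or_game Field_beside F)
  ultimately show ?thesis
    by (simp add: input_game_def)
qed

lemma input_game_add_bottom:
  assumes "input_game n R"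
  shows "input_game n (\<lambda>x. add_bottom (R x))"
proof -
  obtain F where F: "\<And>x. length x = n \<Longrightarrow> Field (R x) = F"
    using assms by (metis input_gameE)
  have "input_bit n (\<lambda>x. (a, b) \<in> add_bottom (R x))" for a b
  proof -
    have "input_bit n (\<lambda>x. (a, b) \<in> add_bottom (R x)) \<longleftrightarrow>
      input_bit n (\<lambda>x. case (a, b) of (0, 0) \<Rightarrow> True | (0, Suc b) \<Rightarrow> b \<in> F | (Suc a, 0) \<Rightarrow> False
        | (Suc a, Suc b) \<Rightarrow> (a, b) \<in> R x)"
      by (rule input_bit_cong) (simp add: add_bottom_iff F split: nat.split)
    also have "\<dots>"
      using assms by (cases a; cases b) (simp_all add: input_game_def)
    finally show ?thesis .
  qed
  moreover have "\<exists>F. \<forall>x. length x = n \<longrightarrow> Field (add_bottom (R x)) = F"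
    by (simp add: Field_add_bottom F)
  ultimately show ?thesis
    by (simp add: input_game_def)
qed

lemma input_game_flip:
  assumes "input_game n R"
  shows "input_game n (\<lambda>x. flip k (R x))"
proof (induction k)
  case 0
  then show ?case
    using assms by simp
next
  case (Suc k)
  have "input_game n (\<lambda>x. (add_bottom ^^ m) (flip k (R x)))" for m
    by (induction m) (simp_all add: Suc input_game_add_bottom)
  then show ?case
    by (simp add: bottoms_and_tower_def input_game_beside input_game_const)
qed

lemma input_game_not_game:
  assumes "input_game n R"
  shows "input_game n (\<lambda>x. not_game (R x))"
proof -
  obtain F where F: "\<And>x. length x = n \<Longrightarrow> Field (R x) = F"
    using assms by (metis input_gameE)
  \<comment> \<open>All inputs share the element set \<open>F\<close>, hence the number of loop
    rounds.\<close>
  have "input_game n (\<lambda>x. not_game (R x)) \<longleftrightarrow> input_game n (\<lambda>x. not_game_at (bit_length (card F)) (R x))"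
    by (rule input_game_cong) (simp add: not_game_eq F)
  also have "\<dots>"
    unfolding not_game_at_def by (intro input_game_beside input_game_flip input_game_const assms)
  finally show ?thesis .
qed

lemma input_game_leaf:
  assumes "j < n"
  shows "input_game n (\<lambda>x. leaf 2 (x ! j))"
proof -
  have "Field (leaf 2 b) = {..<2}" for b
    by (auto simp: leaf_def Field_beside Field_tower less_2_cases_iff)
  moreover have "input_bit n (\<lambda>x. (a, b) \<in> leaf 2 (x ! j))" for a b
  proof (cases "(a, b) \<in> leaf 2 True \<longleftrightarrow> (a, b) \<in> leaf 2 False")
    case True
    then have "(a, b) \<in> leaf 2 c \<longleftrightarrow> (a, b) \<in> leaf 2 True" for c
      by (cases c) auto
    then show ?thesis
      unfolding input_bit_def by blast
  next
    case False
    \<comment> \<open>The antichain is contained in the chain, so an entry in which they differ is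
      true exactly for the chain and equals the input bit.\<close>
    have "leaf 2 False \<subseteq> leaf 2 True"
      by (auto simp: leaf_def beside_def tower_def)
    with False have "(a, b) \<in> leaf 2 c \<longleftrightarrow> c" for c
      by (cases c) auto
    then show ?thesis
      using assms by (auto simp: input_bit_def)
  qed
  ultimately show ?thesis
    by (simp add: input_game_def)
qed

lemma input_game_circuit:
  assumes "circuit n C"
  shows "input_game n (\<lambda>x. out_val (padded_gate_game 2 x) C)"
proof -
  have C: "C \<noteq> []"
    using assms by (simp add: circuit_def)
  have "input_game n (\<lambda>x. gate_vals (padded_gate_game 2 x) C ! i)" if "i < length C" for i
    using assms that
  proof (induction rule: circuit_gate_induct)
    case (gate i)
    then show ?case
      by (cases "C ! i")
        (simp_all add: gate_vals_nth[OF gate(1)] and_game_def input_game_const input_game_leaf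
          input_game_not_game input_game_or_game)
  qed
  with C show ?thesis
    by (simp add: out_val_eq)
qed

lemma input_bit_ac_circuit:
  assumes "input_bit n p"
  shows "\<exists>D. ac_circuit n D \<and> length D \<le> 1 \<and> out_val ac_gate_depth D \<le> 1 \<and>
    (\<forall>x. length x = n \<longrightarrow> out_val (ac_gate_eval x) D = p x)"
  using assms unfolding input_bit_def
proof (elim disjE exE conjE)
  fix c
  assume "\<forall>x. length x = n \<longrightarrow> p x = c"
  then show ?thesis
    \<comment> \<open>Constants are the empty conjunction and the empty disjunction, each of depth
      1.\<close>
    by (intro exI[of _ "[if c then AndU [] else OrU []]"]) (simp add: ac_circuit_def)
next
  fix k
  assume "k < n" "\<forall>x. length x = n \<longrightarrow> p x = x ! k"
  then show ?thesis
    by (intro exI[of _ "[InputU k]"]) (simp add: ac_circuit_def)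
qed

section \<open>Hardness\<close>

lemma encode_poset_eq_map:
  "encode_poset m r = map (\<lambda>i. (i div m, i mod m) \<in> r) [0..<m * m]"
proof -
  have "encode_poset m r = map (\<lambda>(i, j). (i, j) \<in> r) (List.product [0..<m] [0..<m])"
    unfolding encode_poset_def product_concat_map by (simp add: map_concat comp_def)
  also have "\<dots> = map (\<lambda>i. (i div m, i mod m) \<in> r) [0..<m * m]"
    by (cases "m = 0") (auto simp: list_eq_iff_nth_eq product_nth less_mult_imp_div_less)
  finally show ?thesis .
qed

text \<open>The length determines \<open>m\<close>, and entry \<open>i * m + j\<close> decides
  \<open>(i, j)\<close>. Hence an encoding belongs to the problem only through its own
  poset.\<close>

lemma encode_poset_inj:
  assumes "encode_poset m r = encode_poset m' r'" "Field r = {..<m}" "Field r' = {..<m'}"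
  shows "r = r'"
proof -
  have "m * m = m' * m'"
    using arg_cong[OF assms(1), of length] by (simp add: encode_poset_eq_map)
  then have m: "m' = m"
    by (metis power2_eq_square power2_eq_iff_nonneg zero_le)
  have "(i, j) \<in> r \<longleftrightarrow> (i, j) \<in> r'" if "i < m" "j < m" for i j
  proof -
    have "i * m + j < Suc i * m"
      using that by simp
    also have "\<dots> \<le> m * m"
      using that by (intro mult_le_mono1) simp
    finally have ij: "i * m + j < m * m" "(i * m + j) div m = i" "(i * m + j) mod m = j"
      using that by simp_all
    show ?thesis
      using arg_cong[OF assms(1), of "\<lambda>xs. xs ! (i * m + j)"] ij by (simp add: encode_poset_eq_map m)
  qed
  moreover have "i < m \<and> j < m" if "(i, j) \<in> r \<or> (i, j) \<in> r'" for i j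
    using that assms(2,3) m by (metis FieldI1 FieldI2 lessThan_iff)
  ultimately show ?thesis
    by auto
qed

lemma encode_poset_mem_iff:
  assumes "Field r = {..<m}" "finite_poset r"
  shows "encode_poset m r \<in> poset_game_problem \<longleftrightarrow> first_player_win r"
  unfolding poset_game_problem_def using assms encode_poset_inj by blast

text \<open>The reduction for one input length: only relation entries depend on the input, each
  being a constant or an input bit, so one gate per output bit suffices.\<close>

lemma circuit_reduction:
  assumes "circuit n C"
  shows "\<exists>m D. m \<le> 2 * 648 ^ circuit_depth C \<and>
    (\<forall>i < m * m. ac_circuit n (D i) \<and> length (D i) \<le> 1 \<and> out_val ac_gate_depth (D i) \<le> 1) \<and>
    (\<forall>x. length x = n \<longrightarrow>
      (map (\<lambda>i. out_val (ac_gate_eval x) (D i)) [0..<m * m] \<in> poset_game_problem \<longleftrightarrow> circuit_eval C x))"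
proof -
  define R where "R x = out_val (padded_gate_game 2 x) C" for x
  have rep: "represents (R x) (circuit_eval C x) (circuit_depth C)" for x
    unfolding R_def using assms by (rule represents_circuit) simp
  have R: "input_game n R"
    unfolding R_def using assms by (rule input_game_circuit)
  then obtain F where F: "\<And>x. length x = n \<Longrightarrow> Field (R x) = F"
    by (metis input_gameE)
  have "finite F" and card_F: "card F \<le> 2 * 648 ^ circuit_depth C"
    \<comment> \<open>Any input of length \<open>n\<close> would serve as a sample, since all give
      the same \<open>F\<close>.\<close>
    using rep[of "replicate n True"] F[of "replicate n True"] by (auto simp: represents_def finite_poset_def)
  \<comment> \<open>A single numbering \<open>h\<close> for all inputs keeps each matrix entry at a
    fixed place.\<close>
  then obtain h where h: "bij_betw h F {..<card F}"
    using ex_bij_betw_finite_nat by (metis atLeast0LessThan)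
  define m where "m = card F"
  define S where "S x = map_prod h h ` R x" for x
  have S: "finite_poset (S x)" "first_player_win (S x) \<longleftrightarrow> circuit_eval C x" "Field (S x) = {..<m}"
    if "length x = n" for x
  proof -
    have fp: "finite_poset (R x)" and "inj_on h (Field (R x))"
      using rep[of x] h F[OF that] by (auto simp: represents_def bij_betw_def)
    note image = grundy_image[OF this]
    show "finite_poset (S x)"
      using image by (simp add: S_def)
    then show "first_player_win (S x) \<longleftrightarrow> circuit_eval C x"
      using image rep[of x] by (simp add: first_player_win_iff_grundy represents_def S_def)
    show "Field (S x) = {..<m}"
      using h F[OF that] by (simp add: S_def Field_map_prod bij_betw_def m_def)
  qed
  have "input_bit n (\<lambda>x. (i, j) \<in> S x)" if ij: "i < m" "j < m" for i j
  proof -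
    let ?g = "inv_into F h"
    have g: "?g i \<in> F" "?g j \<in> F" "h (?g i) = i" "h (?g j) = j"
      using ij h by (auto simp: m_def bij_betw_def inv_into_into f_inv_into_f)
    have "(i, j) \<in> S x \<longleftrightarrow> (?g i, ?g j) \<in> R x" if "length x = n" for x
    proof
      assume "(i, j) \<in> S x"
      then obtain a b where ab: "(a, b) \<in> R x" "i = h a" "j = h b"
        by (auto simp: S_def)
      moreover have "a \<in> F" "b \<in> F"
        using ab F[OF that] by (metis FieldI1, metis FieldI2)
      ultimately show "(?g i, ?g j) \<in> R x"
        using h by (simp add: bij_betw_def)
    next
      assume "(?g i, ?g j) \<in> R x"
      then show "(i, j) \<in> S x"
        unfolding S_def using g by (metis image_eqI map_prod_simp)
    qed
    then show ?thesis
      using R input_bit_cong[of n "\<lambda>x. (i, j) \<in> S x" "\<lambda>x. (?g i, ?g j) \<in> R x"] by (simp add: input_game_def)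
  qed
  then have "\<exists>D. ac_circuit n D \<and> length D \<le> 1 \<and> out_val ac_gate_depth D \<le> 1 \<and>
      (\<forall>x. length x = n \<longrightarrow> out_val (ac_gate_eval x) D = ((i div m, i mod m) \<in> S x))" if "i < m * m" for i
    using that by (intro input_bit_ac_circuit) (metis gr_zeroI less_mult_imp_div_less mod_less_divisor mult_0 not_less0)
  then obtain D where D: "ac_circuit n (D i) \<and> length (D i) \<le> 1 \<and> out_val ac_gate_depth (D i) \<le> 1 \<and>
      (\<forall>x. length x = n \<longrightarrow> out_val (ac_gate_eval x) (D i) = ((i div m, i mod m) \<in> S x))" if "i < m * m" for i
    by metis
  have "map (\<lambda>i. out_val (ac_gate_eval x) (D i)) [0..<m * m] = encode_poset m (S x)" if "length x = n" for x
    unfolding encode_poset_eq_map using D that by simp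
  then have "\<forall>x. length x = n \<longrightarrow>
      (map (\<lambda>i. out_val (ac_gate_eval x) (D i)) [0..<m * m] \<in> poset_game_problem \<longleftrightarrow> circuit_eval C x)"
    using S encode_poset_mem_iff by metis
  then show ?thesis
    using D card_F unfolding m_def[symmetric] by blast
qed

section \<open>Polynomial bounds and the hardness theorem\<close>

lemma polynomially_bounded_mono:
  assumes "polynomially_bounded q" "\<And>n. p n \<le> q n"
  shows "polynomially_bounded p"
proof -
  obtain k where "(\<lambda>n. real (q n)) \<in> O(\<lambda>n. real n ^ k)"
    using assms(1) by (auto simp: polynomially_bounded_def)
  moreover have "(\<lambda>n. real (p n)) \<in> O(\<lambda>n. real (q n))"
    using assms(2) by (intro landau_o.big_mono) simp
  ultimately show ?thesis
    unfolding polynomially_bounded_def using landau_o.big_trans by blast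
qed

lemma polynomially_bounded_mult:
  assumes "polynomially_bounded p" "polynomially_bounded q"
  shows "polynomially_bounded (\<lambda>n. p n * q n)"
proof -
  obtain k l where "(\<lambda>n. real (p n)) \<in> O(\<lambda>n. real n ^ k)" "(\<lambda>n. real (q n)) \<in> O(\<lambda>n. real n ^ l)"
    using assms by (auto simp: polynomially_bounded_def)
  from landau_o.big.mult[OF this] have "(\<lambda>n. real (p n * q n)) \<in> O(\<lambda>n. real n ^ (k + l))"
    by (simp add: power_add)
  then show ?thesis
    unfolding polynomially_bounded_def by blast
qed

text \<open>Since \<open>b ^ (c * ln n) = n ^ (c * ln b)\<close>, logarithmic exponents give
  polynomial growth; the degree \<open>k\<close> is \<open>c * ln b\<close> rounded up.\<close>

lemma polynomially_bounded_power_log: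
  assumes "(\<lambda>n. real (d n)) \<in> O(\<lambda>n. ln (real n))" "0 < b"
  shows "polynomially_bounded (\<lambda>n. a * b ^ d n)"
proof -
  obtain c where c: "c > 0" "eventually (\<lambda>n. norm (real (d n)) \<le> c * norm (ln (real n))) at_top"
    using assms(1) by (auto elim: landau_o.bigE)
  define k where "k = nat \<lceil>c * ln (real b)\<rceil>"
  have "eventually (\<lambda>n. norm (real (a * b ^ d n)) \<le> real a * norm (real n ^ k)) at_top"
    using c(2) eventually_ge_at_top[of 1]
  proof eventually_elim
    case (elim n)
    have ln: "0 \<le> ln (real n)" "0 \<le> ln (real b)"
      using elim assms(2) by simp_all
    have "ln (real b) * real (d n) \<le> ln (real b) * (c * ln (real n))"
      using elim ln by (intro mult_left_mono) auto
    also have "\<dots> = c * ln (real b) * ln (real n)"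
      by simp
    also have "\<dots> \<le> real k * ln (real n)"
      unfolding k_def using ln by (intro mult_right_mono real_nat_ceiling_ge)
    finally have "exp (ln (real b) * real (d n)) \<le> exp (real k * ln (real n))"
      by simp
    moreover have "exp (ln (real b) * real (d n)) = real b ^ d n"
      using assms(2) by (simp add: exp_of_nat2_mult)
    moreover have "exp (real k * ln (real n)) = real n ^ k"
      using elim by (simp add: exp_of_nat_mult)
    ultimately have "real b ^ d n \<le> real n ^ k"
      by simp
    then show ?case
      by (simp add: mult_left_mono)
  qed
  then show ?thesis
    unfolding polynomially_bounded_def by (blast intro: landau_o.bigI)
qed

theorem NC1_hard_poset_game_problem: "NC1_hard poset_game_problem"
  unfolding NC1_hard_def
proof
  fix A
  assume "A \<in> NC1"
  then obtain C where circuit: "\<And>n. circuit n (C n)"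
    and depth: "(\<lambda>n. real (circuit_depth (C n))) \<in> O(\<lambda>n. ln (real n))"
    and A: "\<And>x. x \<in> A \<longleftrightarrow> circuit_eval (C (length x)) x"
    by (auto simp: NC1_def)
  obtain m D where m: "\<And>n. m n \<le> 2 * 648 ^ circuit_depth (C n)"
    and D: "\<And>n i. i < m n * m n \<Longrightarrow> ac_circuit n (D n i) \<and> length (D n i) \<le> 1 \<and> out_val ac_gate_depth (D n i) \<le> 1"
    and red: "\<And>x. map (\<lambda>i. out_val (ac_gate_eval x) (D (length x) i)) [0..<m (length x) * m (length x)]
      \<in> poset_game_problem \<longleftrightarrow> circuit_eval (C (length x)) x"
    using circuit_reduction[OF circuit] by metis
  have "polynomially_bounded m"
    by (rule polynomially_bounded_mono[OF polynomially_bounded_power_log[OF depth] m]) simp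
  then have "polynomially_bounded (\<lambda>n. m n * m n)"
    by (intro polynomially_bounded_mult)
  moreover have "polynomially_bounded (\<lambda>_. 1)"
    unfolding polynomially_bounded_def by (intro exI[of _ 0]) simp
  ultimately show "reduces_efficiently A poset_game_problem"
    unfolding reduces_efficiently_def using D red A
    by (intro exI[of _ "\<lambda>n. m n * m n"] exI[of _ D] exI[of _ "\<lambda>_. 1"] exI[of _ 1]) simp
qed

section \<open>The prescribed construction: the case of leaf parameter 1\<close>

lemma circuit_game:
  assumes "circuit n C"
  shows "finite_poset (circuit_game C x)" "first_player_win (circuit_game C x) \<longleftrightarrow> circuit_eval C x"
    and "card (Field (circuit_game C x)) \<le> 2 * 648 ^ circuit_depth C"
  using represents_circuit[OF assms, of 1 x]
  by (auto simp: circuit_game_def gate_game_eq_padded represents_def first_player_win_iff_grundy)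

theorem mainTheorem4:
  "(\<forall>n C x. circuit n C \<and> length x = n \<longrightarrow>
      finite_poset (circuit_game C x) \<and>
      (first_player_win (circuit_game C x) \<longleftrightarrow> circuit_eval C x)) \<and>
   (\<forall>c :: real. \<exists>p. polynomially_bounded p \<and>
      (\<forall>n F C x. circuit n F \<and> circuit n C \<and>
          (\<forall>y. length y = n \<longrightarrow> circuit_eval C y = circuit_eval F y) \<and>
          real (circuit_depth C) \<le> c * ln (real n) + c \<and> length x = n \<longrightarrow>
        finite_poset (circuit_game C x) \<and>
        (first_player_win (circuit_game C x) \<longleftrightarrow> circuit_eval F x) \<and>
        card (Field (circuit_game C x)) \<le> p n)) \<and>
   NC1_hard poset_game_problem"
proof (intro conjI allI NC1_hard_poset_game_problem)
  fix c :: real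
  \<comment> \<open>The largest depth allowed by the bound, with \<open>\<bar>c\<bar>\<close>
    covering negative \<open>c\<close>.\<close>
  define d where "d n = nat \<lfloor>\<bar>c\<bar> * ln (real n) + \<bar>c\<bar>\<rfloor>" for n
  have "(\<lambda>n. real (d n)) \<in> O(\<lambda>n. ln (real n))"
  proof (rule landau_o.bigI)
    \<comment> \<open>From \<open>n = 3\<close> on, \<open>ln n \<ge> 1\<close> absorbs the additive
      \<open>\<bar>c\<bar>\<close>; the summand 1 keeps the constant positive for
      \<open>c = 0\<close>.\<close>
    show "eventually (\<lambda>n. norm (real (d n)) \<le> (2 * \<bar>c\<bar> + 1) * norm (ln (real n))) at_top"
      using eventually_ge_at_top[of 3]
    proof eventually_elim
      case (elim n)
      have "exp 1 \<le> real n"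
        using exp_le elim by linarith
      then have ln: "1 \<le> ln (real n)"
        using elim by (subst ln_ge_iff) auto
      have "real (d n) \<le> \<bar>c\<bar> * ln (real n) + \<bar>c\<bar>"
        unfolding d_def using ln by (intro of_nat_floor) simp
      also have "\<dots> \<le> \<bar>c\<bar> * ln (real n) + \<bar>c\<bar> * ln (real n) + ln (real n)"
        using ln mult_left_mono[OF ln, of "\<bar>c\<bar>"] by simp
      finally show ?case
        using ln by (simp add: algebra_simps)
    qed
  qed simp
  then have "polynomially_bounded (\<lambda>n. 2 * 648 ^ d n)"
    by (rule polynomially_bounded_power_log) simp
  moreover have "card (Field (circuit_game C x)) \<le> 2 * 648 ^ d n"
    if "circuit n C" "real (circuit_depth C) \<le> c * ln (real n) + c" for n C x
  proof -
    \<comment> \<open>This includes \<open>n = 0\<close>, where \<open>ln 0 = 0\<close>.\<close>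
    have "0 \<le> ln (real n)"
      by (cases n) simp_all
    then have "c * ln (real n) + c \<le> \<bar>c\<bar> * ln (real n) + \<bar>c\<bar>"
      by (intro add_mono mult_right_mono) simp_all
    with that(2) have "circuit_depth C \<le> d n"
      unfolding d_def by (intro le_nat_floor) linarith
    then have "2 * 648 ^ circuit_depth C \<le> 2 * (648 :: nat) ^ d n"
      by (simp add: power_increasing)
    with circuit_game(3)[OF that(1), of x] show ?thesis
      by (rule order_trans)
  qed
  ultimately show "\<exists>p. polynomially_bounded p \<and>
      (\<forall>n F C x. circuit n F \<and> circuit n C \<and>
          (\<forall>y. length y = n \<longrightarrow> circuit_eval C y = circuit_eval F y) \<and>
          real (circuit_depth C) \<le> c * ln (real n) + c \<and> length x = n \<longrightarrow>
        finite_poset (circuit_game C x) \<and>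
        (first_player_win (circuit_game C x) \<longleftrightarrow> circuit_eval F x) \<and>
        card (Field (circuit_game C x)) \<le> p n)"
    using circuit_game by (intro exI[of _ "\<lambda>n. 2 * 648 ^ d n"]) auto
qed (use circuit_game in auto)

end
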